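(* Let $C_l>0$ and $C_u>0$, let $\gamma=(y_1,\dots,y_l,y^{gt}_{l+1},\dots,y^{gt}_n)^\top\in\{-1,+1\}^n$, and let the kernel matrix be $\bar K=\gamma\gamma^\top$, so that $K=\gamma\gamma^\top+D$. Then the global minimum of the non-convex problem $$\min_{v\in\mathbb{R}^n}\ \tfrac12 v^\top K^{-1}v\quad\text{s.t.}\quad y_iv_i\ge 1\ (i=1,\dots,l),\qquad v_i^2\ge 1\ (i=l+1,\dots,n)$$ is $v^\star=\gamma$, and $(v,V)=(\gamma,\gamma\gamma^\top)$ is the optimal solution of the semidefinite program $$\min_{v\in\mathbb{R}^n,\,V\in\mathbb{S}^n}\ \tfrac12\langle K^{-1},V\rangle\quad\text{s.t.}\quad y_iv_i\ge 1\ (i=1,\dots,l),\qquad V_{ii}\ge 1\ (i=1,\dots,n),\qquad \begin{pmatrix}V&v\\ v^\top&1\end{pmatrix}\succeq 0.$$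
   Context: Setting (semi-supervised support vector machines): there are $n$ data points, of which the first $l$ ($1\le l<n$) carry given labels $y_1,\dots,y_l\in\{-1,+1\}$, and the points $l+1,\dots,n$ are unlabeled; $y_i^{gt}\in\{-1,+1\}$ denotes the (ground-truth) label of the unlabeled point $i$, $i=l+1,\dots,n$. The numbers $C_l,C_u$ are penalty parameters. $D$ is the $n\times n$ diagonal matrix with $D_{ii}=\frac1{2C_l}$ for $i=1,\dots,l$ and $D_{ii}=\frac1{2C_u}$ for $i=l+1,\dots,n$. For a symmetric positive semidefinite kernel matrix $\bar K$ one sets $K=\bar K+D$, which is positive definite. $\mathbb{S}^n$ is the set of real symmetric $n\times n$ matrices, $\langle A,B\rangle=\operatorname{tr}(B^\top A)$, and $M\succeq0$ means $M$ is positive semidefinite. *)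

theory Defs
  imports Complex_Main "Jordan_Normal_Form.Gauss_Jordan_Elimination"
begin

text \<open>Data points, vector entries and matrix entries are indexed from 0: the points
  \<open>i < l\<close> are labelled, the points \<open>l \<le> i < n\<close> are unlabelled.\<close>

definition sym_mats :: "nat \<Rightarrow> real mat set" where
  "sym_mats n = {A \<in> carrier_mat n n. transpose_mat A = A}"

definition psd_mat :: "nat \<Rightarrow> real mat \<Rightarrow> bool" where
  "psd_mat n A \<longleftrightarrow> A \<in> sym_mats n \<and> (\<forall>x \<in> carrier_vec n. 0 \<le> x \<bullet> (A *\<^sub>v x))"

definition tr_mat :: "real mat \<Rightarrow> real" where
  "tr_mat A = (\<Sum>i<dim_row A. A $$ (i, i))"

definition inner_mat :: "real mat \<Rightarrow> real mat \<Rightarrow> real" where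
  "inner_mat A B = tr_mat (transpose_mat B * A)"

text \<open>Unspecified for singular matrices; it is only applied to positive definite ones.\<close>

definition inv_mat :: "real mat \<Rightarrow> real mat" where
  "inv_mat A = the (mat_inverse A)"

definition col_vec_mat :: "real vec \<Rightarrow> real mat" where
  "col_vec_mat v = mat_of_cols (dim_vec v) [v]"

definition penalty_mat :: "nat \<Rightarrow> nat \<Rightarrow> real \<Rightarrow> real \<Rightarrow> real mat" where
  "penalty_mat n l C\<^sub>l C\<^sub>u = mat_diag n (\<lambda>i. if i < l then 1 / (2 * C\<^sub>l) else 1 / (2 * C\<^sub>u))"

definition nonconvex_feasible :: "nat \<Rightarrow> nat \<Rightarrow> (nat \<Rightarrow> real) \<Rightarrow> real vec \<Rightarrow> bool" where
  "nonconvex_feasible n l y v \<longleftrightarrow>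
     v \<in> carrier_vec n \<and>
     (\<forall>i<l. y i * v $ i \<ge> 1) \<and>
     (\<forall>i. l \<le> i \<and> i < n \<longrightarrow> (v $ i)\<^sup>2 \<ge> 1)"

definition nonconvex_objective :: "real mat \<Rightarrow> real vec \<Rightarrow> real" where
  "nonconvex_objective K v = 1 / 2 * (v \<bullet> (inv_mat K *\<^sub>v v))"

definition sdp_feasible :: "nat \<Rightarrow> nat \<Rightarrow> (nat \<Rightarrow> real) \<Rightarrow> real vec \<times> real mat \<Rightarrow> bool" where
  "sdp_feasible n l y = (\<lambda>(v, V).
     v \<in> carrier_vec n \<and> V \<in> sym_mats n \<and>
     (\<forall>i<l. y i * v $ i \<ge> 1) \<and>
     (\<forall>i<n. V $$ (i, i) \<ge> 1) \<and>
     psd_mat (n + 1)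
       (four_block_mat V (col_vec_mat v) (transpose_mat (col_vec_mat v)) (1\<^sub>m 1)))"

definition sdp_objective :: "real mat \<Rightarrow> real vec \<times> real mat \<Rightarrow> real" where
  "sdp_objective K = (\<lambda>(v, V). 1 / 2 * inner_mat (inv_mat K) V)"

end

theory Submission
  imports Defs
begin

text \<open>
  Write \<open>g\<close> for the sign vector \<open>\<gamma>\<close>, \<open>d\<^sub>i > 0\<close> for the diagonal entries of the penalty matrix,
  and \<open>W = \<Sum>\<^sub>i 1 / d\<^sub>i\<close>. Since \<open>K\<close> is a rank-one perturbation of a diagonal matrix, the
  Sherman-Morrison formula gives its inverse explicitly (\<open>inv_mat_outer_plus_diag\<close>). Substituting it
  and using \<open>g\<^sub>i\<^sup>2 = 1\<close> one finds (\<open>inner_inverse_eq_discrepancy\<close>)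

  \<open>(1 + W) \<langle>K\<inverse>, V\<rangle> = \<Sum>\<^sub>i V\<^sub>i\<^sub>i / d\<^sub>i + 1/2 \<Sum>\<^sub>i\<^sub>j (V\<^sub>i\<^sub>i + V\<^sub>j\<^sub>j - 2 g\<^sub>i g\<^sub>j V\<^sub>i\<^sub>j) / (d\<^sub>i d\<^sub>j)\<close>.

  The bracket is the quadratic form of \<open>V\<close> at \<open>g\<^sub>i e\<^sub>i - g\<^sub>j e\<^sub>j\<close>, hence nonnegative when \<open>V\<close> is positive
  semidefinite, and \<open>V\<^sub>i\<^sub>i \<ge> 1\<close> bounds the first sum below by \<open>W\<close>. At \<open>V = g g\<^sup>T\<close> every bracket
  vanishes and every \<open>V\<^sub>i\<^sub>i\<close> is \<open>1\<close>, so \<open>(g, g g\<^sup>T)\<close> is optimal. Conversely, an optimal \<open>V\<close> must have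
  \<open>V\<^sub>i\<^sub>i = 1\<close> and all brackets zero, which says \<open>V = g g\<^sup>T\<close> (\<open>sdp_objective_ge\<close>). The bordered
  matrix constraint then forces \<open>v\<close> to be a multiple of \<open>g\<close> by a factor in \<open>[-1, 1]\<close>, and a single
  labelled point fixes this factor to be \<open>1\<close> (\<open>border_determined\<close>).

  The non-convex problem is the restriction of the semidefinite program to the pairs \<open>(v, v v\<^sup>T)\<close>:
  feasibility is preserved and the objectives agree. As the unique optimum of the larger problem lies
  in this smaller set, it is also the unique optimum there.
\<close>

section \<open>Outer products and positive semidefinite matrices\<close>

text \<open>Entrywise form of \<open>v v\<^sup>T\<close>; it keeps the two factors from being multiplied out as matrices.\<close>

definition outer :: "real vec \<Rightarrow> real mat" where
  "outer v = mat (dim_vec v) (dim_vec v) (\<lambda>(i, j). v $ i * v $ j)"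

lemma outer_carrier: "v \<in> carrier_vec n \<Longrightarrow> outer v \<in> carrier_mat n n"
  by (auto simp: outer_def)

lemma outer_index:
  assumes "v \<in> carrier_vec n" "i < n" "j < n"
  shows "outer v $$ (i, j) = v $ i * v $ j"
  using assms by (auto simp: outer_def)

lemma col_vec_mat_times_transpose: "col_vec_mat v * transpose_mat (col_vec_mat v) = outer v"
  by (rule eq_matI) (auto simp: outer_def col_vec_mat_def scalar_prod_def mat_of_cols_index)

lemma outer_sym: "v \<in> carrier_vec n \<Longrightarrow> outer v \<in> sym_mats n"
  by (auto simp: sym_mats_def outer_def intro!: eq_matI)

lemma quadratic_form_sum:
  fixes A :: "real mat"
  assumes "A \<in> carrier_mat n n" "x \<in> carrier_vec n"
  shows "x \<bullet> (A *\<^sub>v x) = (\<Sum>i<n. \<Sum>j<n. x $ i * x $ j * A $$ (i, j))"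
  using assms by (auto simp: scalar_prod_def sum_distrib_left atLeast0LessThan mult.assoc
      mult.commute[of "A $$ _"] intro!: sum.cong)

lemma psd_outer:
  assumes v: "v \<in> carrier_vec n"
  shows "psd_mat n (outer v)"
  unfolding psd_mat_def
proof (intro conjI ballI outer_sym v)
  fix x :: "real vec" assume x: "x \<in> carrier_vec n"
  have "x \<bullet> (outer v *\<^sub>v x) = (\<Sum>i<n. \<Sum>j<n. (x $ i * v $ i) * (x $ j * v $ j))"
    unfolding quadratic_form_sum[OF outer_carrier[OF v] x]
    by (auto simp: outer_index[OF v] ac_simps intro!: sum.cong)
  also have "\<dots> = (\<Sum>i<n. x $ i * v $ i)\<^sup>2"
    by (simp add: power2_eq_square sum_product)
  finally show "0 \<le> x \<bullet> (outer v *\<^sub>v x)" by simp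
qed

text \<open>Appending the entry \<open>1\<close> to \<open>v\<close> shows that the pairs \<open>(v, v v\<^sup>T)\<close> satisfy the bordered
  matrix constraint.\<close>

lemma bordered_outer:
  assumes "v \<in> carrier_vec n"
  shows "four_block_mat (outer v) (col_vec_mat v) (transpose_mat (col_vec_mat v)) (1\<^sub>m 1)
       = outer (vec (n + 1) (\<lambda>i. if i < n then v $ i else 1))"
  by (rule eq_matI) (use assms in \<open>auto simp: outer_def col_vec_mat_def mat_of_cols_index\<close>)

text \<open>The quadratic form at \<open>p e\<^sub>i + q e\<^sub>j + t e\<^sub>k\<close>. The indices may coincide, which
  spares case distinctions when the inequality is used.\<close>

lemma psd_three_coordinates:
  assumes "psd_mat n A" and ijk: "i < n" "j < n" "k < n"
  shows "0 \<le> p * p * A $$ (i, i) + q * q * A $$ (j, j) + t * t * A $$ (k, k)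
    + 2 * p * q * A $$ (i, j) + 2 * p * t * A $$ (i, k) + 2 * q * t * A $$ (j, k)"
proof -
  have A: "A \<in> carrier_mat n n" and At: "transpose_mat A = A"
    using assms by (auto simp: psd_mat_def sym_mats_def)
  have sym: "A $$ (b, a) = A $$ (a, b)" if "a < n" "b < n" for a b
    using arg_cong[OF At, of "\<lambda>M. M $$ (a, b)"] A that by auto
  let ?f = "\<lambda>a. p * of_bool (a = i) + q * of_bool (a = j) + t * of_bool (a = k)"
  let ?x = "vec n ?f"
  have row: "(\<Sum>b<n. ?f b * c b) = p * c i + q * c j + t * c k" for c :: "nat \<Rightarrow> real"
    using ijk by (simp add: distrib_right sum.distrib mult.assoc of_bool_def if_distrib[of "\<lambda>x. x * _"]
        if_distrib[of "\<lambda>x. _ * x"] sum.delta cong: if_cong)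
  have "0 \<le> ?x \<bullet> (A *\<^sub>v ?x)"
    using assms by (auto simp: psd_mat_def)
  also have "\<dots> = (\<Sum>a<n. \<Sum>b<n. ?f a * ?f b * A $$ (a, b))"
    using A by (subst quadratic_form_sum) auto
  also have "\<dots> = (\<Sum>a<n. ?f a * (\<Sum>b<n. ?f b * A $$ (a, b)))"
    unfolding sum_distrib_left mult.assoc ..
  also have "\<dots> = p * (p * A $$ (i, i) + q * A $$ (i, j) + t * A $$ (i, k))
    + q * (p * A $$ (j, i) + q * A $$ (j, j) + t * A $$ (j, k))
    + t * (p * A $$ (k, i) + q * A $$ (k, j) + t * A $$ (k, k))"
    unfolding row ..
  finally show ?thesis
    using ijk by (simp add: sym[of i j] sym[of i k] sym[of j k] algebra_simps)
qed

section \<open>The inverse of a rank-one perturbation of a diagonal matrix\<close>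

lemma inv_mat_eqI:
  assumes A: "A \<in> carrier_mat n n" and B: "B \<in> carrier_mat n n"
    and AB: "A * B = 1\<^sub>m n" and BA: "B * A = 1\<^sub>m n"
  shows "inv_mat A = B"
proof (cases "mat_inverse A")
  case None
  have "A \<in> Units (ring_mat TYPE(real) n ())"
    using assms by (auto simp: Units_def ring_mat_def)
  with mat_inverse(1)[OF A None, of "()"] show ?thesis by blast
next
  case (Some C)
  from mat_inverse(2)[OF A Some] have C: "C * A = 1\<^sub>m n" "C \<in> carrier_mat n n" by auto
  have "C = C * (A * B)" using C AB by simp
  also have "\<dots> = B" using C A B by (simp add: assoc_mult_mat[symmetric, of _ n n _ n _ n])
  finally show ?thesis using Some by (simp add: inv_mat_def)
qed

lemma index_mult_mat_sum:
  assumes "A \<in> carrier_mat n n" "B \<in> carrier_mat n n" "i < n" "j < n"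
  shows "(A * B) $$ (i, j) = (\<Sum>k<n. A $$ (i, k) * B $$ (k, j))"
  using assms by (auto simp: scalar_prod_def atLeast0LessThan intro!: sum.cong)

text \<open>The Sherman-Morrison formula for \<open>diag d + g g\<^sup>T\<close>.\<close>

lemma inv_mat_outer_plus_diag:
  fixes d :: "nat \<Rightarrow> real"
  assumes g: "g \<in> carrier_vec n" and d: "\<And>i. i < n \<Longrightarrow> d i > 0"
  defines "W \<equiv> (\<Sum>k<n. (g $ k)\<^sup>2 / d k)"
  shows "inv_mat (outer g + mat_diag n d) =
    mat n n (\<lambda>(i, j). (if i = j then 1 / d i else 0) - g $ i / d i * (g $ j / d j) / (1 + W))"
    (is "inv_mat ?K = ?S")
proof -
  have W: "1 + W > 0"
    unfolding W_def using d by (intro add_pos_nonneg sum_nonneg) (auto intro!: divide_nonneg_pos)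
  have K: "?K \<in> carrier_mat n n" using outer_carrier[OF g] by auto
  have Kij: "?K $$ (i, j) = g $ i * g $ j + (if i = j then d j else 0)" if "i < n" "j < n" for i j
    using that outer_carrier[OF g] by (simp add: outer_index[OF g] mat_diag_def)
  have S: "?S \<in> carrier_mat n n" by simp
  have KS: "?K * ?S = 1\<^sub>m n"
  proof (rule eq_matI)
    fix i j assume "i < dim_row (1\<^sub>m n :: real mat)" "j < dim_col (1\<^sub>m n :: real mat)"
    hence ij: "i < n" "j < n" by auto
    have "(?K * ?S) $$ (i, j) = (\<Sum>k<n. ?K $$ (i, k) * ?S $$ (k, j))"
      by (rule index_mult_mat_sum[OF K S ij])
    \<comment> \<open>Separating the two Kronecker deltas from the remaining summands, which add up to a multiple of \<open>W\<close>.\<close>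
    also have "\<dots> = (\<Sum>k<n. (if k = j then g $ i * g $ j / d j + (if i = j then 1 else 0) else 0)
        - (g $ k)\<^sup>2 / d k * (g $ i * g $ j / d j / (1 + W))
        - (if k = i then g $ i * g $ j / d j / (1 + W) else 0))"
    proof (rule sum.cong)
      fix k assume "k \<in> {..<n}"
      hence k: "k < n" by simp
      show "?K $$ (i, k) * ?S $$ (k, j) = (if k = j then g $ i * g $ j / d j + (if i = j then 1 else 0) else 0)
        - (g $ k)\<^sup>2 / d k * (g $ i * g $ j / d j / (1 + W))
        - (if k = i then g $ i * g $ j / d j / (1 + W) else 0)"
        unfolding Kij[OF ij(1) k] index_mat(1)[OF k ij(2)] prod.case
          divide_inverse[of _ "1 + W"]
        using d[OF k] d[OF ij(2)]
        by (cases "k = i"; cases "k = j")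
          (auto simp: field_simps power2_eq_square simp del: inverse_eq_divide)
    qed simp
    also have "\<dots> = g $ i * g $ j / d j + (if i = j then 1 else 0)
        - W * (g $ i * g $ j / d j / (1 + W)) - g $ i * g $ j / d j / (1 + W)"
      unfolding sum_subtractf sum_distrib_right[symmetric] W_def[symmetric]
      using ij by simp
    also have "\<dots> = (if i = j then 1 else 0)"
      using W d[OF ij(2)] by (simp add: divide_simps) (simp add: algebra_simps)
    also have "\<dots> = 1\<^sub>m n $$ (i, j)" using ij by simp
    finally show "(?K * ?S) $$ (i, j) = 1\<^sub>m n $$ (i, j)" .
  qed (use K S in \<open>simp_all only: carrier_matD index_mult_mat index_one_mat\<close>)
  have Kt: "transpose_mat ?K = ?K"
    using g by (intro eq_matI) (auto simp: outer_def mat_diag_def)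
  have St: "transpose_mat ?S = ?S"
    by (rule eq_matI) (auto simp: mult.commute)
  \<comment> \<open>Both matrices are symmetric, so the other product is the transpose of the one just computed.\<close>
  have "?S * ?K = transpose_mat (?K * ?S)"
    using transpose_mult[OF K S] Kt St by simp
  hence "?S * ?K = 1\<^sub>m n" unfolding KS by simp
  with KS K S show ?thesis by (intro inv_mat_eqI)
qed

section \<open>The optimality gap\<close>

lemma inner_mat_sum:
  assumes "A \<in> carrier_mat n n" "B \<in> carrier_mat n n"
  shows "inner_mat A B = (\<Sum>i<n. \<Sum>j<n. A $$ (j, i) * B $$ (j, i))"
  using assms by (auto simp: inner_mat_def tr_mat_def scalar_prod_def atLeast0LessThan ac_simps intro!: sum.cong)

text \<open>For a sign vector \<open>g\<close> this is the quadratic form of \<open>V\<close> at \<open>g\<^sub>i e\<^sub>i - g\<^sub>j e\<^sub>j\<close>; for a correlation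
  matrix \<open>V\<close> it measures how far \<open>V\<^sub>i\<^sub>j\<close> is from \<open>g\<^sub>i g\<^sub>j\<close>.\<close>

definition discrepancy :: "real vec \<Rightarrow> real mat \<Rightarrow> nat \<Rightarrow> nat \<Rightarrow> real" where
  "discrepancy g V i j = V $$ (i, i) + V $$ (j, j) - 2 * g $ i * g $ j * V $$ (i, j)"

text \<open>By the inversion formula the left-hand side is
  \<open>(1 + W) \<Sum>\<^sub>i V\<^sub>i\<^sub>i / d\<^sub>i - \<Sum>\<^sub>i\<^sub>j g\<^sub>i g\<^sub>j V\<^sub>i\<^sub>j / (d\<^sub>i d\<^sub>j)\<close>. Lagrange's identity turns
  \<open>W \<Sum>\<^sub>i V\<^sub>i\<^sub>i / d\<^sub>i\<close> minus the double sum into the weighted sum of discrepancies: this is the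
  Cauchy-Schwarz inequality with its defect made explicit, so that the case of equality can be read off.\<close>

lemma inner_inverse_eq_discrepancy:
  fixes d :: "nat \<Rightarrow> real"
  assumes g: "g \<in> carrier_vec n" and signs: "\<And>i. i < n \<Longrightarrow> (g $ i)\<^sup>2 = 1"
    and d: "\<And>i. i < n \<Longrightarrow> d i > 0" and V: "V \<in> sym_mats n"
  shows "(1 + (\<Sum>k<n. 1 / d k)) * inner_mat (inv_mat (outer g + mat_diag n d)) V =
    (\<Sum>i<n. V $$ (i, i) / d i) + (\<Sum>i<n. \<Sum>j<n. discrepancy g V i j / (d i * d j)) / 2"
proof -
  define W where "W = (\<Sum>k<n. 1 / d k)"
  define T where "T = (\<Sum>i<n. V $$ (i, i) / d i)"
  define Q where "Q = (\<Sum>i<n. \<Sum>j<n. g $ i / d i * (g $ j / d j) * V $$ (i, j))"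
  have W: "1 + W > 0"
    unfolding W_def using d by (intro add_pos_nonneg sum_nonneg) (auto simp: less_imp_le)
  have Vc: "V \<in> carrier_mat n n" using V by (simp add: sym_mats_def)
  have Vs: "V $$ (b, a) = V $$ (a, b)" if "a < n" "b < n" for a b
    using V that by (metis (mono_tags, lifting) index_transpose_mat(1) mem_Collect_eq sym_mats_def carrier_matD)
  have W_eq: "(\<Sum>k<n. (g $ k)\<^sup>2 / d k) = W"
    unfolding W_def by (intro sum.cong) (auto simp: signs)
  have inv: "inv_mat (outer g + mat_diag n d) =
    mat n n (\<lambda>(i, j). (if i = j then 1 / d i else 0) - g $ i / d i * (g $ j / d j) / (1 + W))"
    unfolding W_eq[symmetric] by (rule inv_mat_outer_plus_diag[OF g d])
  have "inner_mat (inv_mat (outer g + mat_diag n d)) V =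
    (\<Sum>i<n. \<Sum>j<n. (if i = j then V $$ (i, i) / d i else 0) - g $ i / d i * (g $ j / d j) * V $$ (i, j) / (1 + W))"
    unfolding inv
    by (subst inner_mat_sum[OF _ Vc]) (auto intro!: sum.cong simp: Vs field_simps)
  also have "\<dots> = T - Q / (1 + W)"
    by (simp add: sum_subtractf T_def Q_def sum_divide_distrib sum.delta)
  finally have L: "(1 + W) * inner_mat (inv_mat (outer g + mat_diag n d)) V = (1 + W) * T - Q"
    using W by (simp add: field_simps)
  have "(\<Sum>i<n. \<Sum>j<n. discrepancy g V i j / (d i * d j)) =
    (\<Sum>i<n. \<Sum>j<n. V $$ (i, i) / d i * (1 / d j) + 1 / d i * (V $$ (j, j) / d j)
       - 2 * (g $ i / d i * (g $ j / d j) * V $$ (i, j)))"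
    using d by (intro sum.cong) (auto simp: discrepancy_def diff_divide_distrib add_divide_distrib)
  also have "\<dots> = T * W + W * T - 2 * Q"
    unfolding T_def W_def Q_def sum_product sum_subtractf sum.distrib
    by (simp add: sum_distrib_left)
  finally show ?thesis
    using L unfolding W_def[symmetric] T_def[symmetric] by (simp add: algebra_simps)
qed

lemma discrepancy_outer:
  assumes "g \<in> carrier_vec n" "\<And>i. i < n \<Longrightarrow> (g $ i)\<^sup>2 = 1" "i < n" "j < n"
  shows "discrepancy g (outer g) i j = 0"
proof -
  have "2 * g $ i * g $ j * (g $ i * g $ j) = 2 * (g $ i)\<^sup>2 * (g $ j)\<^sup>2"
    by (simp add: power2_eq_square)
  with assms show ?thesis
    by (simp add: discrepancy_def outer_index flip: power2_eq_square)
qed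

section \<open>The bordered matrix constraint\<close>

text \<open>The quadratic form of the bordered matrix at \<open>(p e\<^sub>i + q e\<^sub>j, t)\<close>; all consequences of
  semidefiniteness below are instances of it.\<close>

lemma sdp_feasible_two_coordinates:
  assumes "sdp_feasible n l y (v, V)" and ij: "i < n" "j < n"
  shows "0 \<le> p * p * V $$ (i, i) + q * q * V $$ (j, j) + 2 * p * q * V $$ (i, j)
    + 2 * p * t * v $ i + 2 * q * t * v $ j + t * t"
proof -
  let ?M = "four_block_mat V (col_vec_mat v) (transpose_mat (col_vec_mat v)) (1\<^sub>m 1)"
  have v: "v \<in> carrier_vec n" and V: "V \<in> carrier_mat n n" and M: "psd_mat (n + 1) ?M"
    using assms by (auto simp: sdp_feasible_def sym_mats_def)
  have "?M $$ (a, b) = V $$ (a, b)" "?M $$ (a, n) = v $ a" "?M $$ (n, n) = 1" if "a < n" "b < n" for a b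
    using that v V by (auto simp: col_vec_mat_def mat_of_cols_index)
  with psd_three_coordinates[OF M, of i j n p q t] ij show ?thesis by (simp add: algebra_simps)
qed

lemma discrepancy_nonneg:
  assumes feas: "sdp_feasible n l y (v, V)" and ij: "i < n" "j < n"
    and signs: "(g $ i)\<^sup>2 = 1" "(g $ j)\<^sup>2 = 1"
  shows "discrepancy g V i j \<ge> 0"
  using sdp_feasible_two_coordinates[OF feas ij, of "g $ i" "- g $ j" 0] signs
  by (simp add: discrepancy_def power2_eq_square)

text \<open>The vector \<open>g\<^sub>0 e\<^sub>0\<close> has norm one for \<open>g g\<^sup>T\<close>, which bounds \<open>g\<^sub>0 v\<^sub>0\<close> by \<open>1\<close> and makes the label
  constraint at the point \<open>0\<close> tight. The vectors \<open>g\<^sub>i e\<^sub>i - g\<^sub>0 e\<^sub>0\<close> lie in the kernel of \<open>g g\<^sup>T\<close>, and a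
  kernel vector of the upper left block must be orthogonal to the border \<open>v\<close>, so the value
  \<open>g\<^sub>0 v\<^sub>0 = 1\<close> spreads to all coordinates.\<close>

lemma border_determined:
  assumes feas: "sdp_feasible n l y (v, outer g)" and g: "g \<in> carrier_vec n"
    and signs: "\<And>i. i < n \<Longrightarrow> (g $ i)\<^sup>2 = 1" and labels: "\<And>i. i < l \<Longrightarrow> g $ i = y i"
    and l: "0 < l" "l \<le> n"
  shows "v = g"
proof -
  have n: "0 < n" using l by simp
  have v: "v \<in> carrier_vec n" and v0: "g $ 0 * v $ 0 \<ge> 1"
    using feas labels l by (auto simp: sdp_feasible_def)
  have "g $ 0 * v $ 0 \<le> 1"
    using sdp_feasible_two_coordinates[OF feas n n, of "g $ 0" 0 "-1"] signs[OF n]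
    by (simp add: outer_index[OF g n n] power2_eq_square)
  with v0 have v0: "g $ 0 * v $ 0 = 1" by simp
  have "v $ i = g $ i" if i: "i < n" for i
  proof -
    define e where "e = g $ i * v $ i - 1"
    have null: "g $ i * g $ i = 1" "g $ 0 * g $ 0 = 1"
      using signs[OF i] signs[OF n] by (auto simp: power2_eq_square)
    \<comment> \<open>At \<open>(s (g\<^sub>i e\<^sub>i - g\<^sub>0 e\<^sub>0), 1)\<close> the quadratic part vanishes, and an affine function of \<open>s\<close> remains.\<close>
    have nonneg: "0 \<le> 2 * s * e + 1" for s
    proof -
      have z: "s * g $ i * (s * g $ i) * (g $ i * g $ i) + (- (s * g $ 0)) * (- (s * g $ 0)) * (g $ 0 * g $ 0)
        + 2 * (s * g $ i) * (- (s * g $ 0)) * (g $ i * g $ 0)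
        = s * s * ((g $ i * g $ i) - (g $ 0 * g $ 0))\<^sup>2"
        by (simp add: power2_eq_square algebra_simps)
      have w: "2 * (s * g $ i) * 1 * v $ i + 2 * (- (s * g $ 0)) * 1 * v $ 0 = 2 * s * e"
        using v0 by (simp add: e_def algebra_simps)
      show ?thesis
        using sdp_feasible_two_coordinates[OF feas i n, of "s * g $ i" "- (s * g $ 0)" 1]
        unfolding outer_index[OF g i i] outer_index[OF g n n] outer_index[OF g i n] z
        using null w by simp
    qed
    have "e = 0"
    proof (rule ccontr)
      assume "e \<noteq> 0"
      thus False using nonneg[of "- 1 / e"] by simp
    qed
    hence "g $ i * (g $ i * v $ i) = g $ i" by (simp add: e_def)
    thus ?thesis using null by (simp flip: mult.assoc)
  qed
  with v g show ?thesis by (intro eq_vecI) auto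
qed

section \<open>Optimality and uniqueness\<close>

lemma sdp_objective_gap:
  fixes d :: "nat \<Rightarrow> real"
  assumes g: "g \<in> carrier_vec n" and signs: "\<And>i. i < n \<Longrightarrow> (g $ i)\<^sup>2 = 1"
    and d: "\<And>i. i < n \<Longrightarrow> d i > 0" and V: "V \<in> sym_mats n"
  defines "K \<equiv> outer g + mat_diag n d"
  shows "2 * (1 + (\<Sum>k<n. 1 / d k)) * (sdp_objective K (v, V) - sdp_objective K (g, outer g)) =
    (\<Sum>i<n. (V $$ (i, i) - 1) / d i) + (\<Sum>i<n. \<Sum>j<n. discrepancy g V i j / (d i * d j)) / 2"
proof -
  let ?c = "1 + (\<Sum>k<n. 1 / d k)"
  have inner: "?c * inner_mat (inv_mat K) U =
    (\<Sum>i<n. U $$ (i, i) / d i) + (\<Sum>i<n. \<Sum>j<n. discrepancy g U i j / (d i * d j)) / 2"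
    if "U \<in> sym_mats n" for U
    unfolding K_def by (rule inner_inverse_eq_discrepancy[OF g signs d that])
  have "?c * inner_mat (inv_mat K) (outer g) = (\<Sum>i<n. 1 / d i)"
    unfolding inner[OF outer_sym[OF g]]
    by (auto simp: discrepancy_outer[OF g signs] outer_index[OF g] signs
        simp flip: power2_eq_square intro!: sum.cong)
  moreover have "2 * ?c * (sdp_objective K (v, V) - sdp_objective K (g, outer g))
     = ?c * inner_mat (inv_mat K) V - ?c * inner_mat (inv_mat K) (outer g)"
    by (simp add: sdp_objective_def algebra_simps)
  ultimately show ?thesis
    unfolding inner[OF V] by (simp add: diff_divide_distrib sum_subtractf)
qed

lemma sdp_objective_ge:
  fixes d :: "nat \<Rightarrow> real"
  assumes g: "g \<in> carrier_vec n" and signs: "\<And>i. i < n \<Longrightarrow> (g $ i)\<^sup>2 = 1"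
    and d: "\<And>i. i < n \<Longrightarrow> d i > 0" and feas: "sdp_feasible n l y (v, V)"
  defines "K \<equiv> outer g + mat_diag n d"
  shows "sdp_objective K (g, outer g) \<le> sdp_objective K (v, V)"
    and "sdp_objective K (v, V) \<le> sdp_objective K (g, outer g) \<Longrightarrow> V = outer g"
proof -
  let ?c = "2 * (1 + (\<Sum>k<n. 1 / d k))"
  let ?gap = "sdp_objective K (v, V) - sdp_objective K (g, outer g)"
  let ?A = "\<Sum>i<n. (V $$ (i, i) - 1) / d i"
  let ?B = "\<Sum>i<n. \<Sum>j<n. discrepancy g V i j / (d i * d j)"
  have V: "V \<in> sym_mats n" "\<And>i. i < n \<Longrightarrow> V $$ (i, i) \<ge> 1"
    using feas by (auto simp: sdp_feasible_def)
  have c: "?c > 0"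
    using d by (intro mult_pos_pos add_pos_nonneg sum_nonneg) (auto simp: less_imp_le)
  have gap: "?c * ?gap = ?A + ?B / 2"
    unfolding K_def by (rule sdp_objective_gap[where d = d, OF g signs d V(1)])
  have a: "(V $$ (i, i) - 1) / d i \<ge> 0" if "i < n" for i
    using V(2) d that by (simp add: less_imp_le)
  have b: "discrepancy g V i j / (d i * d j) \<ge> 0" if "i < n" "j < n" for i j
    using discrepancy_nonneg[OF feas that signs signs] d that by (simp add: less_imp_le)
  have A: "?A \<ge> 0" using a by (intro sum_nonneg) auto
  have B: "?B \<ge> 0" using b by (intro sum_nonneg) auto
  have "0 \<le> ?c * ?gap" unfolding gap using A B by simp
  with c show "sdp_objective K (g, outer g) \<le> sdp_objective K (v, V)"
    by (simp add: zero_le_mult_iff)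
  assume "sdp_objective K (v, V) \<le> sdp_objective K (g, outer g)"
  with c have "?c * ?gap \<le> 0" by (simp add: mult_le_0_iff)
  with gap A B have "?A = 0" "?B = 0" by linarith+
  have diag: "V $$ (i, i) = 1" if "i < n" for i
    using \<open>?A = 0\<close> a d[OF that] that by (subst (asm) sum_nonneg_eq_0_iff) auto
  have "(\<Sum>j<n. discrepancy g V i j / (d i * d j)) = 0" if "i < n" for i
    using \<open>?B = 0\<close> b that by (subst (asm) sum_nonneg_eq_0_iff) (auto intro: sum_nonneg)
  hence "discrepancy g V i j / (d i * d j) = 0" if "i < n" "j < n" for i j
    using sum_nonneg_eq_0_iff[of "{..<n}" "\<lambda>j. discrepancy g V i j / (d i * d j)"] b that by simp
  hence disc: "discrepancy g V i j = 0" if "i < n" "j < n" for i j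
    using that d[of i] d[of j] by fastforce
  show "V = outer g"
  proof (rule eq_matI)
    fix i j assume "i < dim_row (outer g)" "j < dim_col (outer g)"
    hence ij: "i < n" "j < n" using outer_carrier[OF g] by auto
    have "g $ i * g $ j * V $$ (i, j) = 1"
      using disc[OF ij] diag ij by (simp add: discrepancy_def)
    hence "(g $ i)\<^sup>2 * (g $ j)\<^sup>2 * V $$ (i, j) = g $ i * g $ j"
      by (simp add: power2_eq_square ac_simps)
    thus "V $$ (i, j) = outer g $$ (i, j)"
      unfolding outer_index[OF g ij] using signs ij by simp
  qed (use V outer_carrier[OF g] in \<open>auto simp: sym_mats_def\<close>)
qed

text \<open>Squaring the constraint \<open>y\<^sub>i v\<^sub>i \<ge> 1\<close> gives \<open>v\<^sub>i\<^sup>2 \<ge> 1\<close> at the labelled points as well, as the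
  diagonal constraint on \<open>v v\<^sup>T\<close> requires.\<close>

lemma nonconvex_feasible_imp_sdp_feasible:
  assumes "nonconvex_feasible n l y v" and "l \<le> n" and y: "\<And>i. i < l \<Longrightarrow> (y i)\<^sup>2 = 1"
  shows "sdp_feasible n l y (v, outer v)"
proof -
  have v: "v \<in> carrier_vec n" using assms by (simp add: nonconvex_feasible_def)
  have "(v $ i)\<^sup>2 \<ge> 1" if "i < n" for i
  proof (cases "i < l")
    case True
    hence "1 \<le> (y i * v $ i)\<^sup>2"
      using assms by (simp add: nonconvex_feasible_def one_le_power)
    thus ?thesis using y[OF True] by (simp add: power_mult_distrib)
  qed (use assms that in \<open>auto simp: nonconvex_feasible_def\<close>)
  with assms v show ?thesis
    unfolding sdp_feasible_def prod.case bordered_outer[OF v]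
    by (intro conjI psd_outer outer_sym)
      (auto simp: outer_index[OF v] nonconvex_feasible_def simp flip: power2_eq_square)
qed

lemma nonconvex_objective_eq_sdp_objective:
  assumes "v \<in> carrier_vec n" "inv_mat K \<in> carrier_mat n n"
  shows "nonconvex_objective K v = sdp_objective K (v, outer v)"
proof -
  have "v \<bullet> (inv_mat K *\<^sub>v v) = inner_mat (inv_mat K) (outer v)"
    unfolding quadratic_form_sum[OF assms(2,1)] inner_mat_sum[OF assms(2) outer_carrier[OF assms(1)]]
    by (subst sum.swap) (auto simp: outer_index[OF assms(1)] ac_simps intro!: sum.cong)
  thus ?thesis by (simp add: nonconvex_objective_def sdp_objective_def)
qed

lemma is_arg_min_singletonI:
  fixes f :: "'a \<Rightarrow> real"
  assumes "P a" "\<And>x. P x \<Longrightarrow> f a \<le> f x" "\<And>x. P x \<Longrightarrow> f x \<le> f a \<Longrightarrow> x = a"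
  shows "{x. is_arg_min f P x} = {a}"
  using assms by (auto simp: is_arg_min_def not_less)

theorem proposition3:
  fixes n l :: nat and C\<^sub>l C\<^sub>u :: real
    and y y\<^sub>g\<^sub>t :: "nat \<Rightarrow> real"
    and \<gamma> :: "real vec" and K_bar K :: "real mat"
  assumes "1 \<le> l" and "l < n"
    and "C\<^sub>l > 0" and "C\<^sub>u > 0"
    and "\<And>i. i < l \<Longrightarrow> y i \<in> {-1, 1}"
    and "\<And>i. l \<le> i \<Longrightarrow> i < n \<Longrightarrow> y\<^sub>g\<^sub>t i \<in> {-1, 1}"
    and "\<gamma> = vec n (\<lambda>i. if i < l then y i else y\<^sub>g\<^sub>t i)"
    and "K_bar = col_vec_mat \<gamma> * transpose_mat (col_vec_mat \<gamma>)"
    and "K = K_bar + penalty_mat n l C\<^sub>l C\<^sub>u"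
  shows "{v. is_arg_min (nonconvex_objective K) (nonconvex_feasible n l y) v} = {\<gamma>} \<and>
    {p. is_arg_min (sdp_objective K) (sdp_feasible n l y) p} =
      {(\<gamma>, col_vec_mat \<gamma> * transpose_mat (col_vec_mat \<gamma>))}"
proof -
  define d where "d = (\<lambda>i. if i < l then 1 / (2 * C\<^sub>l) else 1 / (2 * C\<^sub>u))"
  have d: "d i > 0" for i using assms(3,4) by (simp add: d_def)
  have K: "K = outer \<gamma> + mat_diag n d"
    using assms(8,9) by (simp add: penalty_mat_def d_def col_vec_mat_times_transpose)
  have g: "\<gamma> \<in> carrier_vec n" using assms(7) by simp
  have y: "(y i)\<^sup>2 = 1" if "i < l" for i using assms(5)[OF that] by auto
  have labels: "\<gamma> $ i = y i" if "i < l" for i using that assms(2,7) by simp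
  have signs: "(\<gamma> $ i)\<^sup>2 = 1" if "i < n" for i
    using that assms(6)[of i] y[of i] assms(7) by (cases "i < l") auto
  have inv: "inv_mat K \<in> carrier_mat n n"
    unfolding K inv_mat_outer_plus_diag[where d = d, OF g d] by simp
  have g_feas: "nonconvex_feasible n l y \<gamma>"
    unfolding nonconvex_feasible_def using g signs labels y by (auto simp flip: power2_eq_square)
  have lift: "sdp_feasible n l y (v, outer v)" if "nonconvex_feasible n l y v" for v
    by (rule nonconvex_feasible_imp_sdp_feasible[OF that less_imp_le[OF assms(2)] y])
  have ge: "sdp_objective K (\<gamma>, outer \<gamma>) \<le> sdp_objective K p" if "sdp_feasible n l y p" for p
    using sdp_objective_ge(1)[where d = d, OF g signs d, where v = "fst p" and V = "snd p"] that by (simp add: K)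
  have unique: "p = (\<gamma>, outer \<gamma>)"
    if feas: "sdp_feasible n l y p" and le: "sdp_objective K p \<le> sdp_objective K (\<gamma>, outer \<gamma>)" for p
  proof (cases p)
    case (Pair v V)
    have V: "V = outer \<gamma>"
      using sdp_objective_ge(2)[where d = d, OF g signs d feas[unfolded Pair]] le by (simp add: K Pair)
    have "v = \<gamma>"
      using border_determined[OF feas[unfolded Pair V] g signs labels] assms(1,2) by simp
    with V Pair show ?thesis by simp
  qed
  have obj: "nonconvex_objective K v = sdp_objective K (v, outer v)" if "nonconvex_feasible n l y v" for v
    using that inv by (intro nonconvex_objective_eq_sdp_objective) (auto simp: nonconvex_feasible_def)
  show ?thesis
    unfolding col_vec_mat_times_transpose
  proof
    show "{v. is_arg_min (nonconvex_objective K) (nonconvex_feasible n l y) v} = {\<gamma>}"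
    proof (rule is_arg_min_singletonI)
      fix v assume v: "nonconvex_feasible n l y v"
      show "nonconvex_objective K \<gamma> \<le> nonconvex_objective K v"
        unfolding obj[OF v] obj[OF g_feas] by (rule ge[OF lift[OF v]])
      assume "nonconvex_objective K v \<le> nonconvex_objective K \<gamma>"
      thus "v = \<gamma>"
        unfolding obj[OF v] obj[OF g_feas] using unique[OF lift[OF v]] by simp
    qed (rule g_feas)
    show "{p. is_arg_min (sdp_objective K) (sdp_feasible n l y) p} = {(\<gamma>, outer \<gamma>)}"
      by (rule is_arg_min_singletonI) (fact lift[OF g_feas] ge unique)+
  qed
qed

end
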